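(* Define rational arrays $A^{(k)}=(A^{(k)}_{i,j})_{i,j\ge 0}$, $k\ge 1$, recursively by $A^{(1)}_{i,j}=\binom{i+j}{i}$ and, for $k\ge 1$ and all $i,j\ge 0$, $$A^{(k+1)}_{i,j}=\frac{A^{(k)}_{i+1,j+1}\;A^{(1)}_{i,j}}{A^{(k)}_{1,\,i+j+1}}.$$ Then for every $k\ge 1$ this recursion produces the Pascal determinantal array of order $k$, i.e. $A^{(k)}_{i,j}=P^{(k)}_{i,j}$ for all $i,j\ge 0$. Equivalently, for all $k\ge 1$ and $i,j\ge 0$, $$P^{(k+1)}_{i,j}=\frac{P^{(k)}_{i+1,j+1}\;P^{(1)}_{i,j}}{P^{(k)}_{1,\,i+j+1}}.$$
   Context: The Pascal array is the infinite array $P=(P_{i,j})_{i,j\ge 0}$ with $P_{i,j}=\binom{i+j}{i}$. For $k\ge 1$ and $i,j\ge 0$, $P^{(k)}_{i,j}$ denotes the determinant of the $k\times k$ contiguous subarray of $P$ with top-left corner at $(i,j)$: $$P^{(k)}_{i,j}=\det\big(P_{i+a,\,j+b}\big)_{0\le a,b\le k-1}.$$ The Pascal determinantal array of order $k$ is $PD_k=(P^{(k)}_{i,j})_{i,j\ge 0}$. *)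

theory Defs
  imports Complex_Main "Jordan_Normal_Form.Determinant"
begin

definition pascal :: "nat \<Rightarrow> nat \<Rightarrow> rat" where
  "pascal i j = of_nat ((i + j) choose i)"

definition pascal_det :: "nat \<Rightarrow> nat \<Rightarrow> nat \<Rightarrow> rat" where
  "pascal_det k i j = det (mat k k (\<lambda>(a, b). pascal (i + a) (j + b)))"

(* The order k starts at 1; the value at order 0 is left unspecified.
   Division is total with x / 0 = 0, so this equation alone does not ensure
   that the denominators are nonzero. *)
fun rec_array :: "nat \<Rightarrow> nat \<Rightarrow> nat \<Rightarrow> rat" where
  "rec_array (Suc 0) i j = of_nat ((i + j) choose i)"
| "rec_array (Suc (Suc k)) i j =
     rec_array (Suc k) (i + 1) (j + 1) * rec_array (Suc 0) i j / rec_array (Suc k) 1 (i + j + 1)"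

end

theory Submission imports Defs
begin

text \<open>Writing $n = i + j$, the entry $(a,b)$ of the block is
  $\frac{(n+a)!}{(i+a)!}\,{n+a+b \choose b}\,\frac{b!}{(j+b)!}$, and Vandermonde's convolution
  ${n+a+b \choose b} = \sum_m {a \choose m}{n+b \choose b-m}$ factors the middle term into
  unitriangular matrices. Hence the determinant is
  $\prod_{l<k} l!\,(n+l)!/((i+l)!\,(j+l)!)$, and in this form the recursion telescopes.\<close>

text \<open>The outer factors depend only on \<open>a\<close> and only on \<open>b\<close>, so they
  merely scale rows and columns of the block.\<close>

lemma pascal_shift_conv_fact:
  "pascal (i + a) (j + b) =
     (fact (i + j + a) / fact (i + a)) * of_nat ((i + j + a + b) choose b) * (fact b / fact (j + b))"
proof -
  have "pascal (i + a) (j + b) = fact (i + j + a + b) / (fact (i + a) * fact (j + b))"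
    unfolding pascal_def using binomial_fact[of "i + a" "i + a + (j + b)", where ?'a = rat]
    by (simp add: ac_simps)
  moreover have "(of_nat ((i + j + a + b) choose b) :: rat) =
      fact (i + j + a + b) / (fact b * fact (i + j + a))"
    using binomial_fact[of b "i + j + a + b", where ?'a = rat] by simp
  ultimately show ?thesis by simp
qed

text \<open>A summation range independent of \<open>a\<close> and \<open>b\<close> makes this an
  entry of a matrix product. The \<open>if\<close> is essential: for \<open>m > b\<close>, truncated
  \<open>b - m\<close> is 0 and the binomial would be 1.\<close>

lemma choose_add_conv_sum:
  assumes "b < k"
  shows "((n + a + b) choose b) =
    (\<Sum>m<k. (a choose m) * (if m \<le> b then (n + b) choose (b - m) else 0))"
proof -
  have "((n + a + b) choose b) = (\<Sum>m\<le>b. (a choose m) * ((n + b) choose (b - m)))"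
    using vandermonde[of a "n + b" b] by (simp add: ac_simps)
  also have "\<dots> = (\<Sum>m<k. (a choose m) * (if m \<le> b then (n + b) choose (b - m) else 0))"
    using assms by (intro sum.mono_neutral_cong_left) auto
  finally show ?thesis .
qed

lemma pascal_det_conv_prod:
  "pascal_det k i j = (\<Prod>l<k. fact l * fact (i + j + l) / (fact (i + l) * fact (j + l)))"
proof -
  define L :: "rat mat" where
    "L = mat k k (\<lambda>(a, m). fact (i + j + a) / fact (i + a) * of_nat (a choose m))"
  define U :: "rat mat" where
    "U = mat k k (\<lambda>(m, b).
       of_nat (if m \<le> b then (i + j + b) choose (b - m) else 0) * (fact b / fact (j + b)))"
  have carrier: "L \<in> carrier_mat k k" "U \<in> carrier_mat k k"
    by (simp_all add: L_def U_def)
  have "mat k k (\<lambda>(a, b). pascal (i + a) (j + b)) = L * U"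
  proof (rule eq_matI)
    fix a b assume "a < dim_row (L * U)" "b < dim_col (L * U)"
    then have ab: "a < k" "b < k" by (simp_all add: L_def U_def)
    have "pascal (i + a) (j + b) = (\<Sum>m<k. L $$ (a, m) * U $$ (m, b))"
      unfolding pascal_shift_conv_fact choose_add_conv_sum[OF ab(2)] of_nat_sum
        sum_distrib_left sum_distrib_right
      using ab by (intro sum.cong) (simp_all add: L_def U_def)
    then show "mat k k (\<lambda>(a, b). pascal (i + a) (j + b)) $$ (a, b) = (L * U) $$ (a, b)"
      using ab carrier by (simp add: scalar_prod_def atLeast0LessThan)
  qed (simp_all add: L_def U_def)
  then have "pascal_det k i j = det L * det U"
    by (simp add: pascal_det_def det_mult[OF carrier])
  \<comment> \<open>\<open>a choose m\<close> vanishes above the diagonal and is 1 on it, so only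
    the row scalings remain.\<close>
  also have "det L = (\<Prod>l<k. fact (i + j + l) / fact (i + l))"
    by (subst det_lower_triangular[OF _ carrier(1)])
      (simp_all add: L_def prod_list_diag_prod atLeast0LessThan)
  also have "det U = (\<Prod>l<k. fact l / fact (j + l))"
    by (subst det_upper_triangular[OF _ carrier(2)])
      (simp_all add: U_def prod_list_diag_prod atLeast0LessThan upper_triangular_def)
  finally show ?thesis
    by (simp add: ac_simps flip: prod.distrib)
qed

text \<open>Every factor of the product is a quotient of factorials. This makes the divisions in the
  recursion genuine.\<close>

lemma pascal_det_nonzero: "pascal_det k i j \<noteq> 0"
  by (simp add: pascal_det_conv_prod)

lemma pascal_det_1: "pascal_det (Suc 0) i j = of_nat ((i + j) choose i)"
  by (simp add: pascal_det_conv_prod binomial_fact)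

lemma pascal_det_Suc:
  "pascal_det (Suc k) i j =
     pascal_det k (i + 1) (j + 1) * pascal_det 1 i j / pascal_det k 1 (i + j + 1)"
proof -
  \<comment> \<open>The factor at \<open>l = 0\<close> is
    \<open>fact (i + j) / (fact i * fact j)\<close>, the determinant of order 1.\<close>
  have "pascal_det (Suc k) i j = pascal_det 1 i j *
      (\<Prod>l<k. fact (Suc l) * fact (i + j + Suc l) / (fact (i + Suc l) * fact (j + Suc l)))"
    by (simp add: pascal_det_conv_prod prod.lessThan_Suc_shift
        del: fact_Suc prod.lessThan_Suc)
  \<comment> \<open>Both determinants on the right have the same numerators
    \<open>fact l * fact (i + j + 2 + l)\<close>, which cancel factor by factor.\<close>
  also have "(\<Prod>l<k. fact (Suc l) * fact (i + j + Suc l) / (fact (i + Suc l) * fact (j + Suc l))) =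
      pascal_det k (i + 1) (j + 1) / pascal_det k 1 (i + j + 1)"
    unfolding pascal_det_conv_prod prod_dividef[symmetric]
    by (intro prod.cong refl) (simp add: divide_simps del: fact_Suc)
  finally show ?thesis
    by (simp add: mult.commute)
qed

lemma rec_array_eq_pascal_det: "rec_array (Suc k) i j = pascal_det (Suc k) i j"
proof (induction k arbitrary: i j)
  case 0
  show ?case by (simp add: pascal_det_1)
next
  case (Suc k)
  show ?case
    by (simp add: Suc.IH pascal_det_Suc[of "Suc k"] pascal_det_1)
qed

theorem mainTheorem2:
  fixes k :: nat
  assumes "k \<ge> 1"
  shows "(\<forall>i j. rec_array k 1 (i + j + 1) \<noteq> 0 \<and> rec_array k i j = pascal_det k i j) \<and>
    (\<forall>i j. pascal_det k 1 (i + j + 1) \<noteq> 0 \<and>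
       pascal_det (k + 1) i j =
         pascal_det k (i + 1) (j + 1) * pascal_det 1 i j / pascal_det k 1 (i + j + 1))"
proof -
  obtain k' where "k = Suc k'"
    using assms by (cases k) auto
  then have "rec_array k i j = pascal_det k i j" for i j
    by (simp only: rec_array_eq_pascal_det)
  then show ?thesis
    using pascal_det_nonzero pascal_det_Suc[of k] by simp
qed

end
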